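(* Let $(\mathbf{X}, d)$ be a proper geodesic space and let $\Omega\subsetneq\mathbf{X}$ be a bounded domain. Let $u:\Omega\to\mathbb{R}$ be $\infty$-superharmonic in $\Omega$. Then $u$ is locally Lipschitz in $\Omega$. More precisely, for any $x\in\Omega$ and $y\in B_r(x)$ with $0<2r<d(x,\partial\Omega)$, $$|u(x)-u(y)|\le\frac{\max\{u(x),u(y)\}-\inf_\Omega u}{r}\,d(x,y).$$ Symmetrically, if $u:\Omega\to\mathbb{R}$ is $\infty$-subharmonic in $\Omega$, then $u$ is locally Lipschitz in $\Omega$ and, for any $x\in\Omega$ and $y\in B_r(x)$ with $0<2r<d(x,\partial\Omega)$, $$|u(x)-u(y)|\le\frac{\sup_\Omega u-\min\{u(x),u(y)\}}{r}\,d(x,y).$$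
   Context: A metric space $(\mathbf{X},d)$ is a geodesic space if any $x,y\in\mathbf{X}$ are joined by a Lipschitz curve of length $d(x,y)$; it is proper if all closed balls $\overline{B_r(x)}$ are compact. $B_r(x)$ is the open metric ball. A domain is a nonempty connected open set. $\mathcal{O}\subset\subset\Omega$ means $\overline{\mathcal{O}}\subset\Omega$. $\infty$-superharmonic: a function $u:\Omega\to\mathbb{R}$ bounded from below is $\infty$-superharmonic in $\Omega$ if for any $\hat{x}\in\Omega$, $a\in\mathbb{R}$, $\kappa\le 0$ and any bounded open set $\mathcal{O}\subset\subset\Omega$ with $\hat{x}\in\Omega\setminus\mathcal{O}$, if $u\ge\phi$ on $\partial\mathcal{O}$, where $\phi=a+\kappa d(\hat{x},\cdot)$, then $u\ge\phi$ in $\overline{\mathcal{O}}$. A function $u$ bounded from above is $\infty$-subharmonic if $-u$ is $\infty$-superharmonic. No continuity of $u$ is assumed. *)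

theory Defs
  imports "HOL-Analysis.Analysis"
begin

text \<open>The metric space \<open>X\<close> is the whole type \<open>'a\<close>; a function \<open>u : \<Omega> \<rightarrow> \<real>\<close> is a total function
  whose values outside \<open>\<Omega>\<close> are never used.\<close>

text \<open>Length of a curve parametrised by \<open>[0,1]\<close>, as the supremum over all partitions; it may be
  \<open>\<infinity>\<close>. Lists with fewer than two points contribute 0.\<close>

definition curve_length :: "(real \<Rightarrow> 'a::metric_space) \<Rightarrow> ereal" where
  "curve_length \<gamma> =
     (SUP ts \<in> {ts. sorted ts \<and> set ts \<subseteq> {0..1}}.
        ereal (\<Sum>i<length ts - 1. dist (\<gamma> (ts ! i)) (\<gamma> (ts ! Suc i))))"

definition geodesic_space :: "'a::metric_space itself \<Rightarrow> bool" where
  "geodesic_space _ \<longleftrightarrow>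
     (\<forall>x y :: 'a. \<exists>\<gamma> L. L-lipschitz_on {0..1} \<gamma> \<and> pathstart \<gamma> = x \<and> pathfinish \<gamma> = y \<and>
        curve_length \<gamma> = ereal (dist x y))"

definition proper_space :: "'a::metric_space itself \<Rightarrow> bool" where
  "proper_space _ \<longleftrightarrow> (\<forall>(x :: 'a) r. compact (cball x r))"

definition bounded_domain :: "'a::metric_space set \<Rightarrow> bool" where
  "bounded_domain \<Omega> \<longleftrightarrow> \<Omega> \<noteq> {} \<and> open \<Omega> \<and> connected \<Omega> \<and> bounded \<Omega>"

definition infty_superharmonic_on :: "'a::metric_space set \<Rightarrow> ('a \<Rightarrow> real) \<Rightarrow> bool" where
  "infty_superharmonic_on \<Omega> u \<longleftrightarrow>
     bdd_below (u ` \<Omega>) \<and>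
     (\<forall>xhat a \<kappa> U. xhat \<in> \<Omega> \<longrightarrow> \<kappa> \<le> 0 \<longrightarrow>
        bounded U \<longrightarrow> open U \<longrightarrow> closure U \<subseteq> \<Omega> \<longrightarrow> xhat \<in> \<Omega> - U \<longrightarrow>
        (\<forall>z \<in> frontier U. u z \<ge> a + \<kappa> * dist xhat z) \<longrightarrow>
        (\<forall>z \<in> closure U. u z \<ge> a + \<kappa> * dist xhat z))"

definition infty_subharmonic_on :: "'a::metric_space set \<Rightarrow> ('a \<Rightarrow> real) \<Rightarrow> bool" where
  "infty_subharmonic_on \<Omega> u \<longleftrightarrow>
     bdd_above (u ` \<Omega>) \<and> infty_superharmonic_on \<Omega> (\<lambda>x. - u x)"

definition locally_lipschitz_on :: "'a::metric_space set \<Rightarrow> ('a \<Rightarrow> real) \<Rightarrow> bool" where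
  "locally_lipschitz_on \<Omega> u \<longleftrightarrow>
     (\<forall>x \<in> \<Omega>. \<exists>\<epsilon> > 0. \<exists>L. L-lipschitz_on (ball x \<epsilon> \<inter> \<Omega>) u)"

end

theory Submission
  imports Defs
begin

text \<open>
  Everything follows from one comparison with a cone. Let \<open>m\<close> be a lower bound of the
  superharmonic function \<open>u\<close> and let \<open>cball p \<rho> \<subseteq> \<Omega>\<close>. The cone with vertex \<open>p\<close>, height \<open>u p\<close> there
  and height \<open>m\<close> on the sphere of radius \<open>\<rho>\<close> lies below \<open>u\<close> at \<open>p\<close> and on that sphere, and these
  points contain the boundary of the punctured ball \<open>ball p \<rho> - {p}\<close>. The vertex is outside the
  punctured ball, so comparison applies and \<open>u\<close> stays above the cone inside: seen from \<open>p\<close>, it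
  drops at most at the rate \<open>(u p - m) / \<rho>\<close> (\<open>superharmonic_drop_le\<close>).

  This one-sided estimate, used with vertex \<open>x\<close> and with vertex \<open>y\<close>, gives the two-sided estimate.
  The ball of radius \<open>r\<close> around \<open>y \<in> ball x r\<close> fits into \<open>cball x (2 * r)\<close>, which explains the
  condition \<open>2 * r < d(x, \<partial>\<Omega>)\<close>. Geodesics enter only to show that \<open>cball x (2 * r) \<subseteq> \<Omega>\<close>
  (\<open>cball_subset_if_less_infdist_frontier\<close>): in a general metric space a ball may reach points
  outside \<open>\<Omega>\<close> without meeting the frontier.

  For the local Lipschitz property the rate must be uniform near a point, that is, \<open>u\<close> must be
  locally bounded above. This is again the drop estimate: where \<open>u\<close> is very large it cannot drop to
  \<open>u x\<close> within a short distance. The subharmonic case is the superharmonic one for \<open>- u\<close>.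
\<close>

lemma superharmonic_INF_le:
  assumes "infty_superharmonic_on \<Omega> u" "z \<in> \<Omega>"
  shows "(INF z\<in>\<Omega>. u z) \<le> u z"
proof (rule cINF_lower)
  show "bdd_below (u ` \<Omega>)" using assms(1) unfolding infty_superharmonic_on_def by (rule conjunct1)
qed (rule assms(2))

text \<open>The vertex must be removed from the ball: comparison requires it to lie outside the open set,
  and as a boundary point it is where the cone is allowed to touch \<open>u\<close>.\<close>

lemma superharmonic_drop_le:
  fixes \<Omega> :: "'a::metric_space set"
  assumes sup: "infty_superharmonic_on \<Omega> u"
    and m: "\<And>z. z \<in> \<Omega> \<Longrightarrow> m \<le> u z"
    and \<rho>: "0 < \<rho>" "cball p \<rho> \<subseteq> \<Omega>"
    and y: "y \<in> ball p \<rho>"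
  shows "u p - u y \<le> (u p - m) / \<rho> * dist p y"
proof (cases "y = p")
  case True
  then show ?thesis by simp
next
  case False
  define U where "U = ball p \<rho> - {p}"
  \<comment> \<open>This slope takes the cone from \<open>u p\<close> down to \<open>m\<close> over the distance \<open>\<rho>\<close>.\<close>
  define \<kappa> where "\<kappa> = - ((u p - m) / \<rho>)"
  have p: "p \<in> \<Omega>" using \<rho> by (meson centre_in_cball less_imp_le subsetD)
  have "\<kappa> \<le> 0" using m[OF p] \<rho> by (simp add: \<kappa>_def)
  have U: "open U" "bounded U" "p \<in> \<Omega> - U"
    using p by (auto simp: U_def intro: bounded_subset[OF bounded_ball])
  have clU: "closure U \<subseteq> cball p \<rho>"
    by (rule closure_minimal) (auto simp: U_def)
  have boundary: "u z \<ge> u p + \<kappa> * dist p z" if "z \<in> frontier U" for z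
  proof -
    have "z \<in> closure U" "z \<notin> U"
      using that \<open>open U\<close> by (auto simp: frontier_def interior_open)
    then consider "z = p" | "dist p z = \<rho>" "z \<in> \<Omega>"
      using clU \<rho>(2) by (force simp: U_def)
    then show ?thesis
      using m \<rho>(1) by cases (auto simp: \<kappa>_def)
  qed
  have yU: "y \<in> closure U"
    using y False closure_subset[of U] by (auto simp: U_def)
  have "\<forall>z\<in>closure U. u z \<ge> u p + \<kappa> * dist p z"
    using sup p \<open>\<kappa> \<le> 0\<close> U boundary order_trans[OF clU \<rho>(2)]
    unfolding infty_superharmonic_on_def by simp
  then have "u y \<ge> u p + \<kappa> * dist p y" using yU by blast
  then show ?thesis by (simp add: \<kappa>_def)
qed

lemma superharmonic_abs_diff_le:
  fixes \<Omega> :: "'a::metric_space set"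
  assumes sup: "infty_superharmonic_on \<Omega> u"
    and m: "\<And>z. z \<in> \<Omega> \<Longrightarrow> m \<le> u z"
    and r: "0 < r" "cball x (2 * r) \<subseteq> \<Omega>"
    and y: "y \<in> ball x r"
  shows "\<bar>u x - u y\<bar> \<le> (max (u x) (u y) - m) / r * dist x y"
proof -
  have "cball x r \<subseteq> \<Omega>" using r by (force intro: order_trans[OF _ r(2)])
  moreover have "cball y r \<subseteq> \<Omega>"
  proof (rule order_trans[OF _ r(2)], rule subsetI)
    fix w assume "w \<in> cball y r"
    then show "w \<in> cball x (2 * r)"
      using y dist_triangle[of x w y] by simp
  qed
  ultimately have "u x - u y \<le> (u x - m) / r * dist x y" "u y - u x \<le> (u y - m) / r * dist x y"
    using superharmonic_drop_le[OF sup m r(1), of x y] superharmonic_drop_le[OF sup m r(1), of y x] y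
    by (auto simp: dist_commute)
  moreover have "(c - m) / r * dist x y \<le> (max (u x) (u y) - m) / r * dist x y"
    if "c \<le> max (u x) (u y)" for c
    using that r(1) by (intro mult_right_mono divide_right_mono) auto
  ultimately show ?thesis
    by (smt (verit))
qed

lemma superharmonic_locally_lipschitz:
  fixes \<Omega> :: "'a::metric_space set"
  assumes sup: "infty_superharmonic_on \<Omega> u" and "open \<Omega>"
  shows "locally_lipschitz_on \<Omega> u"
  unfolding locally_lipschitz_on_def
proof
  fix x assume x: "x \<in> \<Omega>"
  define m where "m = (INF z\<in>\<Omega>. u z)"
  have m: "m \<le> u z" if "z \<in> \<Omega>" for z
    unfolding m_def using sup that by (rule superharmonic_INF_le)
  obtain e where e: "e > 0" "cball x e \<subseteq> \<Omega>"
    using \<open>open \<Omega>\<close> x open_contains_cball by blast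
  \<comment> \<open>With this choice \<open>cball y (2 * \<epsilon>) \<subseteq> cball x e\<close> for \<open>y \<in> ball x \<epsilon>\<close>, and any two points of
      \<open>ball x \<epsilon>\<close> are close enough for the drop estimate with radius \<open>2 * \<epsilon>\<close>.\<close>
  define \<epsilon> where "\<epsilon> = e / 3"
  have \<epsilon>: "\<epsilon> > 0" using e by (simp add: \<epsilon>_def)
  have drop: "u y - u z \<le> (u y - m) / (2 * \<epsilon>) * dist y z"
    if "y \<in> ball x \<epsilon>" "z \<in> ball x \<epsilon>" for y z
  proof (rule superharmonic_drop_le[OF sup m])
    show "cball y (2 * \<epsilon>) \<subseteq> \<Omega>"
    proof (rule order_trans[OF _ e(2)], rule subsetI)
      fix w assume "w \<in> cball y (2 * \<epsilon>)"
      then show "w \<in> cball x e"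
        using that(1) dist_triangle[of x w y] by (simp add: \<epsilon>_def)
    qed
    show "z \<in> ball y (2 * \<epsilon>)"
      using that dist_triangle[of y z x] by (simp add: dist_commute)
  qed (use \<epsilon> in auto)
  \<comment> \<open>Dropping from \<open>u y\<close> to \<open>u x\<close> within distance \<open>\<epsilon>\<close> uses up at most half of \<open>u y - m\<close>,
      which bounds \<open>u y\<close> in terms of \<open>u x\<close>.\<close>
  have bound: "u y - m \<le> 2 * (u x - m)" if y: "y \<in> ball x \<epsilon>" for y
  proof -
    have "y \<in> \<Omega>" using y e by (auto simp: \<epsilon>_def)
    have "u y - u x \<le> (u y - m) / (2 * \<epsilon>) * dist y x"
      using drop y \<epsilon> by simp
    also have "\<dots> \<le> (u y - m) / (2 * \<epsilon>) * \<epsilon>"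
      using y \<epsilon> m[OF \<open>y \<in> \<Omega>\<close>] by (intro mult_left_mono) (auto simp: dist_commute)
    also have "\<dots> = (u y - m) / 2" using \<epsilon> by simp
    finally show ?thesis by simp
  qed
  have diff: "u y - u z \<le> (u x - m) / \<epsilon> * dist y z"
    if "y \<in> ball x \<epsilon>" "z \<in> ball x \<epsilon>" for y z
  proof -
    have "(u y - m) / (2 * \<epsilon>) \<le> 2 * (u x - m) / (2 * \<epsilon>)"
      using bound[OF that(1)] \<epsilon> by (intro divide_right_mono) auto
    also have "\<dots> = (u x - m) / \<epsilon>" by (rule mult_divide_mult_cancel_left) simp
    finally have "(u y - m) / (2 * \<epsilon>) * dist y z \<le> (u x - m) / \<epsilon> * dist y z"
      by (rule mult_right_mono) simp
    then show ?thesis using drop[OF that] by linarith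
  qed
  have "((u x - m) / \<epsilon>)-lipschitz_on (ball x \<epsilon> \<inter> \<Omega>) u"
  proof (rule lipschitz_onI)
    fix y z assume "y \<in> ball x \<epsilon> \<inter> \<Omega>" "z \<in> ball x \<epsilon> \<inter> \<Omega>"
    then show "dist (u y) (u z) \<le> (u x - m) / \<epsilon> * dist y z"
      using diff[of y z] diff[of z y] by (simp add: dist_real_def dist_commute abs_le_iff)
  qed (use m[OF x] \<epsilon> in simp)
  then show "\<exists>\<epsilon>>0. \<exists>L. L-lipschitz_on (ball x \<epsilon> \<inter> \<Omega>) u" using \<epsilon> by blast
qed

lemma dist_le_curve_length:
  assumes "0 \<le> s" "s \<le> t" "t \<le> 1"
  shows "ereal (dist (\<gamma> s) (\<gamma> t)) \<le> curve_length \<gamma>"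
  unfolding curve_length_def
  by (rule SUP_upper2[of "[s, t]"]) (use assms in auto)

text \<open>A geodesic from \<open>x \<in> \<Omega>\<close> to a point outside \<open>\<Omega>\<close> crosses the frontier, and no point of the
  geodesic is farther from \<open>x\<close> than its end point.\<close>

lemma infdist_frontier_le_dist:
  fixes \<Omega> :: "'a::metric_space set"
  assumes geo: "geodesic_space TYPE('a)" and "x \<in> \<Omega>" "z \<notin> \<Omega>"
  shows "infdist x (frontier \<Omega>) \<le> dist x z"
proof -
  obtain \<gamma> L where \<gamma>: "L-lipschitz_on {0..1} \<gamma>" "\<gamma> 0 = x" "\<gamma> 1 = z"
      "curve_length \<gamma> = ereal (dist x z)"
    using geo unfolding geodesic_space_def pathstart_def pathfinish_def by metis
  have "connected (\<gamma> ` {0..1})"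
    using \<gamma>(1) by (intro connected_continuous_image lipschitz_on_continuous_on) auto
  moreover have "x \<in> \<gamma> ` {0..1}" "z \<in> \<gamma> ` {0..1}" using \<gamma>(2,3) by force+
  ultimately have "\<gamma> ` {0..1} \<inter> frontier \<Omega> \<noteq> {}"
    using assms(2,3) by (intro connected_Int_frontier) auto
  then obtain t where t: "0 \<le> t" "t \<le> 1" "\<gamma> t \<in> frontier \<Omega>" by auto
  have "infdist x (frontier \<Omega>) \<le> dist x (\<gamma> t)" by (rule infdist_le[OF t(3)])
  also have "\<dots> \<le> dist x z"
    using dist_le_curve_length[of 0 t \<gamma>] t \<gamma> by simp
  finally show ?thesis .
qed

lemma cball_subset_if_less_infdist_frontier:
  fixes \<Omega> :: "'a::metric_space set"
  assumes "geodesic_space TYPE('a)" "x \<in> \<Omega>" "s < infdist x (frontier \<Omega>)"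
  shows "cball x s \<subseteq> \<Omega>"
  using infdist_frontier_le_dist[OF assms(1,2)] assms(3) by fastforce

lemma locally_lipschitz_on_minus_iff:
  "locally_lipschitz_on \<Omega> (\<lambda>x. - u x) \<longleftrightarrow> locally_lipschitz_on \<Omega> u"
  by (simp add: locally_lipschitz_on_def lipschitz_on_def dist_minus)

theorem lemma2p4:
  fixes \<Omega> :: "'a::metric_space set" and u :: "'a \<Rightarrow> real"
  assumes "proper_space TYPE('a)"
    and "geodesic_space TYPE('a)"
    and "bounded_domain \<Omega>"
    and "\<Omega> \<noteq> UNIV"
  shows "(infty_superharmonic_on \<Omega> u \<longrightarrow>
            locally_lipschitz_on \<Omega> u \<and>
            (\<forall>x \<in> \<Omega>. \<forall>r y. 0 < 2 * r \<and> 2 * r < infdist x (frontier \<Omega>) \<and> y \<in> ball x r \<longrightarrow>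
               \<bar>u x - u y\<bar> \<le> (max (u x) (u y) - (INF z\<in>\<Omega>. u z)) / r * dist x y))
       \<and> (infty_subharmonic_on \<Omega> u \<longrightarrow>
            locally_lipschitz_on \<Omega> u \<and>
            (\<forall>x \<in> \<Omega>. \<forall>r y. 0 < 2 * r \<and> 2 * r < infdist x (frontier \<Omega>) \<and> y \<in> ball x r \<longrightarrow>
               \<bar>u x - u y\<bar> \<le> ((SUP z\<in>\<Omega>. u z) - min (u x) (u y)) / r * dist x y))"
proof -
  have estimate: "\<bar>v x - v y\<bar> \<le> (max (v x) (v y) - m) / r * dist x y"
    if "infty_superharmonic_on \<Omega> v" "\<And>z. z \<in> \<Omega> \<Longrightarrow> m \<le> v z" "x \<in> \<Omega>"
      "0 < 2 * r \<and> 2 * r < infdist x (frontier \<Omega>) \<and> y \<in> ball x r" for v m x r y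
    using that cball_subset_if_less_infdist_frontier[OF assms(2)]
    by (intro superharmonic_abs_diff_le[of \<Omega>]) auto
  have "open \<Omega>" using assms(3) by (simp add: bounded_domain_def)
  note loc_lip = superharmonic_locally_lipschitz[OF _ this]
  show ?thesis
  proof (intro conjI impI ballI allI)
    assume sup: "infty_superharmonic_on \<Omega> u"
    then show "locally_lipschitz_on \<Omega> u" by (rule loc_lip)
    fix x r y
    assume "x \<in> \<Omega>" "0 < 2 * r \<and> 2 * r < infdist x (frontier \<Omega>) \<and> y \<in> ball x r"
    then show "\<bar>u x - u y\<bar> \<le> (max (u x) (u y) - (INF z\<in>\<Omega>. u z)) / r * dist x y"
      using superharmonic_INF_le[OF sup] by (intro estimate[OF sup])
  next
    assume sub: "infty_subharmonic_on \<Omega> u"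
    then have sup: "infty_superharmonic_on \<Omega> (\<lambda>x. - u x)"
      by (simp add: infty_subharmonic_on_def)
    then show "locally_lipschitz_on \<Omega> u"
      using loc_lip locally_lipschitz_on_minus_iff by blast
    fix x r y
    assume "x \<in> \<Omega>" "0 < 2 * r \<and> 2 * r < infdist x (frontier \<Omega>) \<and> y \<in> ball x r"
    moreover have "- (SUP z\<in>\<Omega>. u z) \<le> - u z" if "z \<in> \<Omega>" for z
      using sub that by (simp add: infty_subharmonic_on_def cSUP_upper)
    ultimately have
      "\<bar>- u x - - u y\<bar> \<le> (max (- u x) (- u y) - - (SUP z\<in>\<Omega>. u z)) / r * dist x y"
      by (intro estimate[OF sup])
    then show "\<bar>u x - u y\<bar> \<le> ((SUP z\<in>\<Omega>. u z) - min (u x) (u y)) / r * dist x y"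
      by (simp add: minus_min_eq_max[symmetric] abs_minus_commute add.commute)
  qed
qed

end
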